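(* Let $R$ be a ring. Then the following statements are equivalent. (i) $R$ is a zero-dimensional ring. (ii) Every ideal of $R$ is an N-pure ideal. (iii) Every principal ideal of $R$ is an N-pure ideal. (iv) Every maximal ideal of $R$ is an N-pure ideal. (v) $\sqrt{\mathrm{Ker}\,\pi_{\mathfrak{m}}}=\mathfrak{m}$ for all maximal ideals $\mathfrak{m}$ of $R$. (vi) $R_{\mathfrak{p}}$ is an NJ-ring for all prime ideals $\mathfrak{p}$ of $R$. (vii) $R_{\mathfrak{m}}$ is an NJ-ring for all maximal ideals $\mathfrak{m}$ of $R$.
   Context: All rings are commutative with identity. $\mathfrak{N}$ denotes the nil-radical of $R$. An ideal $I$ of $R$ is called N-pure if for every $a\in I$ there exists $b\in I$ such that $a(1-b)\in\mathfrak{N}$. For a prime ideal $\mathfrak{p}$, $\pi_{\mathfrak{p}}:R\to R_{\mathfrak{p}}$ is the canonical localization map, so $\mathrm{Ker}\,\pi_{\mathfrak{p}}=\{a\in R:\exists s\in R\setminus\mathfrak{p},\ sa=0\}$. A ring is an NJ-ring if its nil-radical and its Jacobson radical are the same. A zero-dimensional ring is a ring in which every prime ideal is maximal. *)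

theory Defs
  imports "HOL-Algebra.QuotRing"
begin

definition radical :: "('a, 'm) ring_scheme \<Rightarrow> 'a set \<Rightarrow> 'a set"
  where "radical R I = {a \<in> carrier R. \<exists>n::nat. n > 0 \<and> a [^]\<^bsub>R\<^esub> n \<in> I}"

definition nilradical :: "('a, 'm) ring_scheme \<Rightarrow> 'a set"
  where "nilradical R = radical R {\<zero>\<^bsub>R\<^esub>}"

text \<open>The intersection of all maximal ideals; if there are none (the zero ring), it is the
  whole ring.\<close>

definition jacobson_radical :: "('a, 'm) ring_scheme \<Rightarrow> 'a set"
  where "jacobson_radical R = {a \<in> carrier R. \<forall>M. maximalideal M R \<longrightarrow> a \<in> M}"

definition NJ_ring :: "('a, 'm) ring_scheme \<Rightarrow> bool"
  where "NJ_ring R \<longleftrightarrow> nilradical R = jacobson_radical R"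

definition N_pure :: "('a, 'm) ring_scheme \<Rightarrow> 'a set \<Rightarrow> bool"
  where "N_pure R I \<longleftrightarrow>
    (\<forall>a\<in>I. \<exists>b\<in>I. a \<otimes>\<^bsub>R\<^esub> (\<one>\<^bsub>R\<^esub> \<ominus>\<^bsub>R\<^esub> b) \<in> nilradical R)"

definition zero_dimensional :: "('a, 'm) ring_scheme \<Rightarrow> bool"
  where "zero_dimensional R \<longleftrightarrow> (\<forall>P. primeideal P R \<longrightarrow> maximalideal P R)"

text \<open>\<open>frac R S a s\<close> is the fraction \<open>a/s\<close>, as the class of \<open>(a, s)\<close> under the usual
  equivalence relation on pairs. The factor \<open>u\<close> is needed because \<open>S\<close> may contain zero divisors.\<close>

definition frac :: "('a, 'm) ring_scheme \<Rightarrow> 'a set \<Rightarrow> 'a \<Rightarrow> 'a \<Rightarrow> ('a \<times> 'a) set"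
  where "frac R S a s = {(b, t). b \<in> carrier R \<and> t \<in> S \<and>
    (\<exists>u\<in>S. u \<otimes>\<^bsub>R\<^esub> ((t \<otimes>\<^bsub>R\<^esub> a) \<ominus>\<^bsub>R\<^esub> (s \<otimes>\<^bsub>R\<^esub> b)) = \<zero>\<^bsub>R\<^esub>)}"

text \<open>The ring of fractions of \<open>R\<close> with denominators in \<open>S\<close>. The unions below run over all
  representatives of the two classes; since the class of the result does not depend on them
  (see \<open>frac_add\<close> and \<open>frac_mult\<close>), they are unions of copies of a single class.\<close>

definition fraction_ring :: "('a, 'm) ring_scheme \<Rightarrow> 'a set \<Rightarrow> ('a \<times> 'a) set ring"
  where "fraction_ring R S =
    \<lparr>carrier = {frac R S a s | a s. a \<in> carrier R \<and> s \<in> S},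
     mult = (\<lambda>X Y. \<Union>(a, s)\<in>X. \<Union>(b, t)\<in>Y. frac R S (a \<otimes>\<^bsub>R\<^esub> b) (s \<otimes>\<^bsub>R\<^esub> t)),
     one = frac R S \<one>\<^bsub>R\<^esub> \<one>\<^bsub>R\<^esub>,
     zero = frac R S \<zero>\<^bsub>R\<^esub> \<one>\<^bsub>R\<^esub>,
     add = (\<lambda>X Y. \<Union>(a, s)\<in>X. \<Union>(b, t)\<in>Y.
       frac R S ((t \<otimes>\<^bsub>R\<^esub> a) \<oplus>\<^bsub>R\<^esub> (s \<otimes>\<^bsub>R\<^esub> b)) (s \<otimes>\<^bsub>R\<^esub> t))\<rparr>"

definition localization :: "('a, 'm) ring_scheme \<Rightarrow> 'a set \<Rightarrow> ('a \<times> 'a) set ring"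
  where "localization R P = fraction_ring R (carrier R - P)"

definition localization_map :: "('a, 'm) ring_scheme \<Rightarrow> 'a set \<Rightarrow> 'a \<Rightarrow> ('a \<times> 'a) set"
  where "localization_map R P a = frac R (carrier R - P) a \<one>\<^bsub>R\<^esub>"

lemma UN_frac_const:
  assumes "\<And>a s b t. (a, s) \<in> X \<Longrightarrow> (b, t) \<in> Y \<Longrightarrow> f a s b t = Z"
    and "(a, s) \<in> X" "(b, t) \<in> Y"
  shows "(\<Union>(a, s)\<in>X. \<Union>(b, t)\<in>Y. f a s b t) = Z"
proof -
  have "(\<Union>(b, t)\<in>Y. f a s b t) = Z" if "(a, s) \<in> X" for a s
    using assms(1)[OF that] assms(3) by (intro SUP_eq_const) auto
  then show ?thesis
    using assms(2) by (intro SUP_eq_const) (blast, simp only: split_paired_all case_prod_conv)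
qed

locale denominators = cring R for R (structure) and S +
  assumes S_sub: "S \<subseteq> carrier R"
    and S_one: "\<one> \<in> S"
    and S_mult: "s \<in> S \<Longrightarrow> t \<in> S \<Longrightarrow> s \<otimes> t \<in> S"
begin

lemma S_carrier [simp]: "s \<in> S \<Longrightarrow> s \<in> carrier R"
  using S_sub by blast

lemma mem_frac_iff:
  assumes "a \<in> carrier R" "s \<in> S" "b \<in> carrier R" "t \<in> S"
  shows "(b, t) \<in> frac R S a s \<longleftrightarrow> (\<exists>u\<in>S. u \<otimes> (t \<otimes> a) = u \<otimes> (s \<otimes> b))"
proof -
  have diff: "x \<ominus> y = \<zero> \<longleftrightarrow> x = y" if "x \<in> carrier R" "y \<in> carrier R" for x y
    using that by (metis minus_eq minus_equality minus_minus r_neg a_inv_closed)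
  have "u \<otimes> (t \<otimes> a \<ominus> s \<otimes> b) = u \<otimes> (t \<otimes> a) \<ominus> u \<otimes> (s \<otimes> b)" if "u \<in> S" for u
    using that assms by (simp add: minus_eq r_distr r_minus)
  then have "u \<otimes> (t \<otimes> a \<ominus> s \<otimes> b) = \<zero> \<longleftrightarrow> u \<otimes> (t \<otimes> a) = u \<otimes> (s \<otimes> b)" if "u \<in> S" for u
    using that assms by (simp add: diff)
  then show ?thesis
    using assms by (auto simp: frac_def)
qed

lemma frac_refl: "a \<in> carrier R \<Longrightarrow> s \<in> S \<Longrightarrow> (a, s) \<in> frac R S a s"
  using S_one by (auto simp: mem_frac_iff)

lemma frac_trans:
  assumes "(b, t) \<in> frac R S a s" "(c, w) \<in> frac R S b t"
    and a: "a \<in> carrier R" "s \<in> S"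
  shows "(c, w) \<in> frac R S a s"
proof -
  have c: "b \<in> carrier R" "t \<in> S" "c \<in> carrier R" "w \<in> S"
    using assms by (auto simp: frac_def)
  obtain u where u: "u \<in> S" "u \<otimes> (t \<otimes> a) = u \<otimes> (s \<otimes> b)"
    using assms c by (auto simp: mem_frac_iff)
  obtain v where v: "v \<in> S" "v \<otimes> (w \<otimes> b) = v \<otimes> (t \<otimes> c)"
    using assms c by (auto simp: mem_frac_iff)
  have "(u \<otimes> v \<otimes> t) \<otimes> (w \<otimes> a) = (v \<otimes> w) \<otimes> (u \<otimes> (t \<otimes> a))"
    using u(1) v(1) a c by (simp add: m_ac)
  also have "\<dots> = (u \<otimes> s) \<otimes> (v \<otimes> (w \<otimes> b))"
    unfolding u(2) using u(1) v(1) a c by (simp add: m_ac)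
  also have "\<dots> = (u \<otimes> v \<otimes> t) \<otimes> (s \<otimes> c)"
    unfolding v(2) using u(1) v(1) a c by (simp add: m_ac)
  finally show ?thesis
    using u(1) v(1) c a S_mult by (auto simp: mem_frac_iff intro!: bexI[of _ "u \<otimes> v \<otimes> t"])
qed

lemma frac_sym:
  assumes "(b, t) \<in> frac R S a s" and a: "a \<in> carrier R" "s \<in> S"
  shows "(a, s) \<in> frac R S b t"
proof -
  have b: "b \<in> carrier R" "t \<in> S"
    using assms by (auto simp: frac_def)
  obtain u where "u \<in> S" "u \<otimes> (t \<otimes> a) = u \<otimes> (s \<otimes> b)"
    using assms(1) mem_frac_iff[OF a b] by blast
  then show ?thesis
    unfolding mem_frac_iff[OF b a] by (metis (no_types))
qed

lemma frac_eqI: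
  assumes "(b, t) \<in> frac R S a s" "a \<in> carrier R" "s \<in> S"
  shows "frac R S b t = frac R S a s"
proof -
  have "b \<in> carrier R" "t \<in> S"
    using assms by (auto simp: frac_def)
  then have "(c, w) \<in> frac R S b t \<longleftrightarrow> (c, w) \<in> frac R S a s" for c w
    using assms frac_sym frac_trans by blast
  then show ?thesis
    by auto
qed

lemma frac_eq_iff:
  assumes a: "a \<in> carrier R" "s \<in> S" and b: "b \<in> carrier R" "t \<in> S"
  shows "frac R S a s = frac R S b t \<longleftrightarrow> (\<exists>u\<in>S. u \<otimes> (t \<otimes> a) = u \<otimes> (s \<otimes> b))"
  unfolding mem_frac_iff[OF a b, symmetric]
  using frac_eqI[OF _ a] frac_refl[OF b] by metis

lemma frac_mult:
  assumes "a \<in> carrier R" "s \<in> S" "b \<in> carrier R" "t \<in> S"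
  shows "frac R S a s \<otimes>\<^bsub>fraction_ring R S\<^esub> frac R S b t = frac R S (a \<otimes> b) (s \<otimes> t)"
proof -
  have "frac R S (a' \<otimes> b') (s' \<otimes> t') = frac R S (a \<otimes> b) (s \<otimes> t)"
    if h: "(a', s') \<in> frac R S a s" "(b', t') \<in> frac R S b t" for a' s' b' t'
  proof -
    have c: "a' \<in> carrier R" "s' \<in> S" "b' \<in> carrier R" "t' \<in> S"
      using h by (auto simp: frac_def)
    obtain u where u: "u \<in> S" "u \<otimes> (s' \<otimes> a) = u \<otimes> (s \<otimes> a')"
      using h assms c by (auto simp: mem_frac_iff)
    obtain v where v: "v \<in> S" "v \<otimes> (t' \<otimes> b) = v \<otimes> (t \<otimes> b')"
      using h assms c by (auto simp: mem_frac_iff)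
    have "(u \<otimes> v) \<otimes> ((s' \<otimes> t') \<otimes> (a \<otimes> b)) = (u \<otimes> (s' \<otimes> a)) \<otimes> (v \<otimes> (t' \<otimes> b))"
      using u(1) v(1) assms c by (simp add: m_ac)
    also have "\<dots> = (u \<otimes> v) \<otimes> ((s \<otimes> t) \<otimes> (a' \<otimes> b'))"
      unfolding u(2) v(2) using u(1) v(1) assms c by (simp add: m_ac)
    finally have "\<exists>w\<in>S. w \<otimes> ((s' \<otimes> t') \<otimes> (a \<otimes> b)) = w \<otimes> ((s \<otimes> t) \<otimes> (a' \<otimes> b'))"
      using S_mult[OF u(1) v(1)] by blast
    then show ?thesis
      by (subst eq_commute, subst frac_eq_iff) (use c assms S_mult in auto)
  qed
  moreover have "(a, s) \<in> frac R S a s" "(b, t) \<in> frac R S b t"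
    using assms frac_refl by auto
  ultimately show ?thesis
    unfolding fraction_ring_def ring.simps monoid.simps by (rule UN_frac_const)
qed

lemma frac_add:
  assumes "a \<in> carrier R" "s \<in> S" "b \<in> carrier R" "t \<in> S"
  shows "frac R S a s \<oplus>\<^bsub>fraction_ring R S\<^esub> frac R S b t
    = frac R S ((t \<otimes> a) \<oplus> (s \<otimes> b)) (s \<otimes> t)"
proof -
  have "frac R S ((t' \<otimes> a') \<oplus> (s' \<otimes> b')) (s' \<otimes> t') = frac R S ((t \<otimes> a) \<oplus> (s \<otimes> b)) (s \<otimes> t)"
    if h: "(a', s') \<in> frac R S a s" "(b', t') \<in> frac R S b t" for a' s' b' t'
  proof -
    have c: "a' \<in> carrier R" "s' \<in> S" "b' \<in> carrier R" "t' \<in> S"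
      using h by (auto simp: frac_def)
    obtain u where u: "u \<in> S" "u \<otimes> (s' \<otimes> a) = u \<otimes> (s \<otimes> a')"
      using h assms c by (auto simp: mem_frac_iff)
    obtain v where v: "v \<in> S" "v \<otimes> (t' \<otimes> b) = v \<otimes> (t \<otimes> b')"
      using h assms c by (auto simp: mem_frac_iff)
    have "(u \<otimes> v) \<otimes> ((s' \<otimes> t') \<otimes> ((t \<otimes> a) \<oplus> (s \<otimes> b)))
      = (v \<otimes> t \<otimes> t') \<otimes> (u \<otimes> (s' \<otimes> a)) \<oplus> (u \<otimes> s \<otimes> s') \<otimes> (v \<otimes> (t' \<otimes> b))"
      using u(1) v(1) assms c by (simp add: m_ac r_distr)
    also have "\<dots> = (u \<otimes> v) \<otimes> ((s \<otimes> t) \<otimes> ((t' \<otimes> a') \<oplus> (s' \<otimes> b')))"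
      unfolding u(2) v(2) using u(1) v(1) assms c by (simp add: m_ac r_distr)
    finally have "\<exists>w\<in>S. w \<otimes> ((s' \<otimes> t') \<otimes> ((t \<otimes> a) \<oplus> (s \<otimes> b))) = w \<otimes> ((s \<otimes> t) \<otimes> ((t' \<otimes> a') \<oplus> (s' \<otimes> b')))"
      using S_mult[OF u(1) v(1)] by blast
    then show ?thesis
      by (subst eq_commute, subst frac_eq_iff) (use c assms S_mult in auto)
  qed
  moreover have "(a, s) \<in> frac R S a s" "(b, t) \<in> frac R S b t"
    using assms frac_refl by auto
  ultimately show ?thesis
    unfolding fraction_ring_def ring.simps monoid.simps by (rule UN_frac_const)
qed

lemma fraction_ring_simps:
  "carrier (fraction_ring R S) = {frac R S a s | a s. a \<in> carrier R \<and> s \<in> S}"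
  "\<one>\<^bsub>fraction_ring R S\<^esub> = frac R S \<one> \<one>"
  "\<zero>\<^bsub>fraction_ring R S\<^esub> = frac R S \<zero> \<one>"
  by (simp_all add: fraction_ring_def)

lemma frac_cancel:
  assumes "a \<in> carrier R" "s \<in> S" "t \<in> S"
  shows "frac R S (t \<otimes> a) (t \<otimes> s) = frac R S a s"
  using assms S_mult S_one by (subst frac_eq_iff) (auto simp: m_ac intro!: bexI[of _ \<one>])

lemma fraction_ring_E:
  assumes "x \<in> carrier (fraction_ring R S)"
  obtains a s where "x = frac R S a s" "a \<in> carrier R" "s \<in> S"
  using assms by (auto simp: fraction_ring_simps(1))

lemma frac_closed: "a \<in> carrier R \<Longrightarrow> s \<in> S \<Longrightarrow> frac R S a s \<in> carrier (fraction_ring R S)"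
  by (auto simp: fraction_ring_simps(1))

lemma fraction_ring_cring: "cring (fraction_ring R S)"
proof (rule cringI)
  let ?F = "fraction_ring R S"
  show "abelian_group ?F"
  proof (rule abelian_groupI)
    fix x y assume "x \<in> carrier ?F" "y \<in> carrier ?F"
    then show "x \<oplus>\<^bsub>?F\<^esub> y \<in> carrier ?F" "x \<oplus>\<^bsub>?F\<^esub> y = y \<oplus>\<^bsub>?F\<^esub> x"
      using S_mult by (elim fraction_ring_E; simp add: frac_add frac_closed m_comm a_comm)+
  next
    show "\<zero>\<^bsub>?F\<^esub> \<in> carrier ?F"
      using S_one by (simp add: fraction_ring_simps(3) frac_closed)
  next
    fix x assume "x \<in> carrier ?F"
    then show "\<zero>\<^bsub>?F\<^esub> \<oplus>\<^bsub>?F\<^esub> x = x"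
      using S_one by (elim fraction_ring_E) (simp add: fraction_ring_simps(3) frac_add)
  next
    fix x y z assume "x \<in> carrier ?F" "y \<in> carrier ?F" "z \<in> carrier ?F"
    then obtain a s b t c w where x: "x = frac R S a s" "y = frac R S b t" "z = frac R S c w"
      and c: "a \<in> carrier R" "s \<in> S" "b \<in> carrier R" "t \<in> S" "c \<in> carrier R" "w \<in> S"
      by (metis fraction_ring_E)
    then show "(x \<oplus>\<^bsub>?F\<^esub> y) \<oplus>\<^bsub>?F\<^esub> z = x \<oplus>\<^bsub>?F\<^esub> (y \<oplus>\<^bsub>?F\<^esub> z)"
      using S_mult by (simp add: frac_add r_distr m_ac a_ac)
  next
    fix x assume "x \<in> carrier ?F"
    then obtain a s where x: "x = frac R S a s" "a \<in> carrier R" "s \<in> S"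
      by (rule fraction_ring_E)
    have "frac R S (s \<otimes> \<ominus> a \<oplus> s \<otimes> a) (s \<otimes> s) = frac R S \<zero> \<one>"
      using x S_mult S_one
      by (subst frac_eq_iff) (auto simp: r_minus l_neg intro!: bexI[of _ \<one>])
    then show "\<exists>y\<in>carrier ?F. y \<oplus>\<^bsub>?F\<^esub> x = \<zero>\<^bsub>?F\<^esub>"
      using x by (intro bexI[of _ "frac R S (\<ominus> a) s"])
        (auto simp: fraction_ring_simps(3) frac_add frac_closed)
  qed
next
  let ?F = "fraction_ring R S"
  show "Group.comm_monoid ?F"
  proof (rule comm_monoidI)
    fix x y assume "x \<in> carrier ?F" "y \<in> carrier ?F"
    then show "x \<otimes>\<^bsub>?F\<^esub> y \<in> carrier ?F" "x \<otimes>\<^bsub>?F\<^esub> y = y \<otimes>\<^bsub>?F\<^esub> x"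
      using S_mult by (elim fraction_ring_E; simp add: frac_mult frac_closed m_comm)+
  next
    show "\<one>\<^bsub>?F\<^esub> \<in> carrier ?F"
      using S_one by (simp add: fraction_ring_simps(2) frac_closed)
  next
    fix x assume "x \<in> carrier ?F"
    then show "\<one>\<^bsub>?F\<^esub> \<otimes>\<^bsub>?F\<^esub> x = x"
      using S_one by (elim fraction_ring_E) (simp add: fraction_ring_simps(2) frac_mult)
  next
    fix x y z assume "x \<in> carrier ?F" "y \<in> carrier ?F" "z \<in> carrier ?F"
    then show "(x \<otimes>\<^bsub>?F\<^esub> y) \<otimes>\<^bsub>?F\<^esub> z = x \<otimes>\<^bsub>?F\<^esub> (y \<otimes>\<^bsub>?F\<^esub> z)"
      using S_mult by (elim fraction_ring_E) (simp add: frac_mult m_assoc)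
  qed
next
  let ?F = "fraction_ring R S"
  fix x y z assume "x \<in> carrier ?F" "y \<in> carrier ?F" "z \<in> carrier ?F"
  then obtain a s b t c w where x: "x = frac R S a s" "y = frac R S b t" "z = frac R S c w"
    and c: "a \<in> carrier R" "s \<in> S" "b \<in> carrier R" "t \<in> S" "c \<in> carrier R" "w \<in> S"
    by (metis fraction_ring_E)
  have "(x \<otimes>\<^bsub>?F\<^esub> z) \<oplus>\<^bsub>?F\<^esub> (y \<otimes>\<^bsub>?F\<^esub> z)
      = frac R S (w \<otimes> ((t \<otimes> a \<oplus> s \<otimes> b) \<otimes> c)) (w \<otimes> ((s \<otimes> t) \<otimes> w))"
    using c S_mult by (simp add: x frac_mult frac_add r_distr l_distr m_ac)
  also have "\<dots> = (x \<oplus>\<^bsub>?F\<^esub> y) \<otimes>\<^bsub>?F\<^esub> z"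
    using c S_mult by (simp add: x frac_mult frac_add frac_cancel)
  finally show "(x \<oplus>\<^bsub>?F\<^esub> y) \<otimes>\<^bsub>?F\<^esub> z = (x \<otimes>\<^bsub>?F\<^esub> z) \<oplus>\<^bsub>?F\<^esub> (y \<otimes>\<^bsub>?F\<^esub> z)" ..
qed

lemma frac_eq_zero_iff:
  assumes "a \<in> carrier R"
  shows "frac R S a \<one> = frac R S \<zero> \<one> \<longleftrightarrow> (\<exists>u\<in>S. u \<otimes> a = \<zero>)"
  using assms S_one by (subst frac_eq_iff) auto

lemma frac_ring_hom: "(\<lambda>a. frac R S a \<one>) \<in> ring_hom R (fraction_ring R S)"
  by (rule ring_hom_memI) (use S_one in \<open>auto simp: fraction_ring_simps frac_mult frac_add\<close>)

end

lemma primeideal_denominators: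
  assumes "primeideal P R"
  shows "denominators R (carrier R - P)"
proof -
  interpret primeideal P R by fact
  show ?thesis
    by unfold_locales (use I_prime I_notcarr one_imp_carrier in auto)
qed

lemma localization_cring: "primeideal P R \<Longrightarrow> cring (localization R P)"
  unfolding localization_def
  by (intro denominators.fraction_ring_cring primeideal_denominators)

lemma localization_map_hom:
  "primeideal P R \<Longrightarrow> localization_map R P \<in> ring_hom R (localization R P)"
  unfolding localization_def localization_map_def [abs_def]
  by (intro denominators.frac_ring_hom primeideal_denominators)

lemma a_kernel_localization_map:
  assumes "primeideal P R"
  shows "a_kernel R (localization R P) (localization_map R P)
    = {a \<in> carrier R. \<exists>s\<in>carrier R - P. s \<otimes>\<^bsub>R\<^esub> a = \<zero>\<^bsub>R\<^esub>}"
proof -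
  interpret denominators R "carrier R - P"
    using assms by (rule primeideal_denominators)
  have "a \<in> a_kernel R (localization R P) (localization_map R P)
      \<longleftrightarrow> a \<in> carrier R \<and> frac R (carrier R - P) a \<one>\<^bsub>R\<^esub> = frac R (carrier R - P) \<zero>\<^bsub>R\<^esub> \<one>\<^bsub>R\<^esub>" for a
    by (simp add: a_kernel_def' localization_def localization_map_def fraction_ring_simps(3))
  then show ?thesis
    using frac_eq_zero_iff by blast
qed

end

(* Each of the seven conditions is equivalent to the following one: whenever a lies in a maximal
   ideal M, some power of a is annihilated by an element outside M, that is, a is nilpotent in R_M.
   For the NJ conditions this holds because the Jacobson radical of R_M is M R_M.
   The condition follows from zero-dimensionality because otherwise the multiplicative set of all s a^n with
   s outside M omits 0, and a prime ideal disjoint from it would lie strictly below M.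
   It yields N-purity of an ideal I containing a, because the annihilators of the powers of a
   together with a generate the unit ideal: 1 = x + r a with x a^n = 0, so b = r a works. *)
theory Submission
  imports Defs
begin

text \<open>Nilpotency in the localization, phrased with elements of \<open>R\<close> only. The
  exponent 0 is allowed: it would force \<open>s\<close> to be zero, which is impossible for
  \<open>s\<close> outside an ideal \<open>M\<close>.\<close>

definition nil_at :: "('a, 'm) ring_scheme \<Rightarrow> 'a set \<Rightarrow> 'a \<Rightarrow> bool"
  where "nil_at R M a \<longleftrightarrow> (\<exists>s\<in>carrier R - M. \<exists>n::nat. s \<otimes>\<^bsub>R\<^esub> a [^]\<^bsub>R\<^esub> n = \<zero>\<^bsub>R\<^esub>)"

section \<open>Existence of prime and maximal ideals\<close>

lemma (in ring) ideal_Union_chain: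
  assumes "C \<noteq> {}" "subset.chain {I. ideal I R} C"
  shows "ideal (\<Union>C) R"
proof (rule idealI[OF ring_axioms])
  have id: "ideal I R" if "I \<in> C" for I
    using assms(2) that by (auto simp: pred_on.chain_def)
  have sub: "I \<subseteq> carrier R" if "I \<in> C" for I
    using id[OF that] by (meson ideal.Icarr subsetI)
  show "subgroup (\<Union>C) (add_monoid R)"
  proof
    show "\<Union>C \<subseteq> carrier (add_monoid R)"
      using sub by auto
    show "\<one>\<^bsub>add_monoid R\<^esub> \<in> \<Union>C"
      using assms(1) id by (auto dest!: ideal.axioms(1) additive_subgroup.zero_closed)
  next
    fix x y assume "x \<in> \<Union>C" "y \<in> \<Union>C"
    then obtain I J where "I \<in> C" "J \<in> C" "x \<in> I" "y \<in> J"
      by blast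
    moreover from this assms(2) have "I \<subseteq> J \<or> J \<subseteq> I"
      by (auto simp: pred_on.chain_def)
    ultimately obtain K where K: "K \<in> C" "x \<in> K" "y \<in> K"
      by blast
    then have "x \<oplus> y \<in> K"
      using id by (intro additive_subgroup.a_closed ideal.axioms(1))
    with K show "x \<otimes>\<^bsub>add_monoid R\<^esub> y \<in> \<Union>C"
      by auto
  next
    fix x assume "x \<in> \<Union>C"
    then obtain I where I: "I \<in> C" "x \<in> I"
      by blast
    then have "\<ominus> x \<in> I"
      using id by (intro additive_subgroup.a_inv_closed ideal.axioms(1))
    with I show "inv\<^bsub>add_monoid R\<^esub> x \<in> \<Union>C"
      by (auto simp: a_inv_def)
  qed
  show "x \<otimes> a \<in> \<Union>C" "a \<otimes> x \<in> \<Union>C" if "a \<in> \<Union>C" "x \<in> carrier R" for a x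
    using that id by (blast intro: ideal.I_l_closed ideal.I_r_closed)+
qed

text \<open>Zorn's lemma, with the union of a chain as its upper bound. A multiplicative set
  \<open>S\<close> will yield a prime ideal, and the set containing only the identity will yield a
  maximal ideal.\<close>

lemma (in ring) exists_maximal_disjoint_ideal:
  assumes "ideal I R" "I \<inter> S = {}"
  obtains P where "ideal P R" "I \<subseteq> P" "P \<inter> S = {}"
    "\<And>J. ideal J R \<Longrightarrow> P \<subseteq> J \<Longrightarrow> J \<inter> S = {} \<Longrightarrow> J = P"
proof -
  let ?A = "{J. ideal J R \<and> I \<subseteq> J \<and> J \<inter> S = {}}"
  have "\<exists>P\<in>?A. \<forall>J\<in>?A. P \<subseteq> J \<longrightarrow> J = P"
  proof (rule subset_Zorn_nonempty)
    show "?A \<noteq> {}"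
      using assms by blast
  next
    fix C assume C: "C \<noteq> {}" "subset.chain ?A C"
    then have "subset.chain {J. ideal J R} C"
      by (auto simp: pred_on.chain_def)
    with C(1) have "ideal (\<Union>C) R"
      by (rule ideal_Union_chain)
    moreover have "I \<subseteq> J \<and> J \<inter> S = {}" if "J \<in> C" for J
      using C(2) that unfolding pred_on.chain_def by blast
    ultimately show "\<Union>C \<in> ?A"
      using C(1) by blast
  qed
  then obtain P where "P \<in> ?A" and max: "\<forall>J\<in>?A. P \<subseteq> J \<longrightarrow> J = P"
    by blast
  then show ?thesis
    by (intro that[of P]) auto
qed

lemma (in cring) mem_add_cgenideal_iff:
  "x \<in> I <+>\<^bsub>R\<^esub> PIdl a \<longleftrightarrow> (\<exists>p\<in>I. \<exists>r\<in>carrier R. x = p \<oplus> r \<otimes> a)"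
  by (auto simp: set_add_def' cgenideal_def)

lemma (in cring) add_cgenideal:
  assumes "ideal I R" "a \<in> carrier R"
  shows "ideal (I <+>\<^bsub>R\<^esub> PIdl a) R" "I \<subseteq> I <+>\<^bsub>R\<^esub> PIdl a" "a \<in> I <+>\<^bsub>R\<^esub> PIdl a"
proof -
  interpret I: ideal I R by fact
  show "ideal (I <+>\<^bsub>R\<^esub> PIdl a) R"
    using assms by (intro add_ideals cgenideal_ideal)
  show "I \<subseteq> I <+>\<^bsub>R\<^esub> PIdl a"
  proof
    fix x assume x: "x \<in> I"
    then have "x = x \<oplus> \<zero> \<otimes> a"
      using assms(2) by simp
    with x show "x \<in> I <+>\<^bsub>R\<^esub> PIdl a"
      unfolding mem_add_cgenideal_iff by blast
  qed
  have "a = \<zero> \<oplus> \<one> \<otimes> a"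
    using assms(2) by simp
  then show "a \<in> I <+>\<^bsub>R\<^esub> PIdl a"
    unfolding mem_add_cgenideal_iff using I.zero_closed by blast
qed

text \<open>An ideal \<open>P\<close> maximal among those disjoint from \<open>S\<close> is prime:
  if \<open>a\<close> and \<open>b\<close> lie outside \<open>P\<close>, then adjoining either of
  them produces an element of \<open>S\<close>, and the product of these two elements lies in
  \<open>S\<close> but also in \<open>P\<close> as soon as \<open>a\<close> times \<open>b\<close>
  does.\<close>

lemma (in denominators) exists_prime_disjoint:
  assumes "\<zero> \<notin> S"
  obtains P where "primeideal P R" "P \<inter> S = {}"
proof -
  have "{\<zero>} \<inter> S = {}"
    using assms by simp
  then obtain P where P: "ideal P R" "P \<inter> S = {}"
    and max: "\<And>J. ideal J R \<Longrightarrow> P \<subseteq> J \<Longrightarrow> J \<inter> S = {} \<Longrightarrow> J = P"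
    using exists_maximal_disjoint_ideal[OF zeroideal, of S] by metis
  interpret P: ideal P R by fact
  have ext: "\<exists>p\<in>P. \<exists>r\<in>carrier R. p \<oplus> r \<otimes> a \<in> S" if "a \<in> carrier R" "a \<notin> P" for a
  proof -
    note J = add_cgenideal[OF P(1) that(1)]
    have "(P <+>\<^bsub>R\<^esub> PIdl a) \<inter> S \<noteq> {}"
      using max[OF J(1,2)] J(3) that(2) by metis
    then obtain x where "x \<in> P <+>\<^bsub>R\<^esub> PIdl a" "x \<in> S"
      by blast
    then show ?thesis
      unfolding mem_add_cgenideal_iff by blast
  qed
  have "primeideal P R"
  proof (rule primeidealI[OF P(1)])
    show "cring R" ..
    show "carrier R \<noteq> P"
      using P(2) S_one by auto
    fix a b assume ab: "a \<in> carrier R" "b \<in> carrier R" "a \<otimes> b \<in> P"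
    show "a \<in> P \<or> b \<in> P"
    proof (rule ccontr)
      assume "\<not> (a \<in> P \<or> b \<in> P)"
      then obtain p r q t where p: "p \<in> P" "r \<in> carrier R" "p \<oplus> r \<otimes> a \<in> S"
        and q: "q \<in> P" "t \<in> carrier R" "q \<oplus> t \<otimes> b \<in> S"
        using ext ab by meson
      have [simp]: "p \<in> carrier R" "q \<in> carrier R"
        using p q P.Icarr by auto
      \<comment> \<open>After expansion every summand has one of \<open>p\<close>, \<open>q\<close>
        and the product of \<open>a\<close> and \<open>b\<close> as a factor.\<close>
      have "(p \<oplus> r \<otimes> a) \<otimes> (q \<oplus> t \<otimes> b)
          = (q \<oplus> t \<otimes> b) \<otimes> p \<oplus> (r \<otimes> a \<otimes> q \<oplus> (r \<otimes> t) \<otimes> (a \<otimes> b))"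
        using ab p(2) q(2) by (simp add: l_distr r_distr m_ac a_ac)
      also have "\<dots> \<in> P"
        using P.I_l_closed[OF p(1)] P.I_l_closed[OF q(1)] P.I_l_closed[OF ab(3)] ab(1,2) p(2) q(2)
        by (intro P.a_closed) auto
      finally show False
        using S_mult[OF p(3) q(3)] P(2) by blast
    qed
  qed
  with P that show ?thesis
    by blast
qed

text \<open>The proper ideals are exactly those that avoid 1, so disjointness from the singleton of
  1 expresses properness.\<close>

lemma (in cring) exists_maximalideal_superset:
  assumes "ideal I R" "I \<noteq> carrier R"
  obtains M where "maximalideal M R" "I \<subseteq> M"
proof -
  have one: "\<one> \<in> J \<longleftrightarrow> J = carrier R" if "ideal J R" for J
    using ideal.one_imp_carrier[OF that] by auto
  have "I \<inter> {\<one>} = {}"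
    using assms one by auto
  then obtain M where M: "ideal M R" "I \<subseteq> M" "M \<inter> {\<one>} = {}"
    and max: "\<And>J. ideal J R \<Longrightarrow> M \<subseteq> J \<Longrightarrow> J \<inter> {\<one>} = {} \<Longrightarrow> J = M"
    using exists_maximal_disjoint_ideal[OF assms(1), of "{\<one>}"] by metis
  have "maximalideal M R"
  proof (rule maximalidealI[OF M(1)])
    show "carrier R \<noteq> M"
      using M(3) by auto
    show "J = M \<or> J = carrier R" if "ideal J R" "M \<subseteq> J" for J
      using max[OF that] one[OF that(1)] by auto
  qed
  with M(2) that show ?thesis
    by blast
qed

section \<open>Powers in prime ideals and the two radicals\<close>

lemma (in primeideal) pow_mem_iff:
  assumes "a \<in> carrier R" "n > (0::nat)"
  shows "a [^] n \<in> I \<longleftrightarrow> a \<in> I"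
  using assms(2)
proof (induction n rule: nat_induct_non_zero)
  case 1
  then show ?case using assms(1) by simp
next
  case (Suc n)
  then show ?case
    using assms(1) I_prime[of "a [^] n" a] I_l_closed[of a "a [^] n"] by auto
qed

text \<open>The case \<open>n = 0\<close> is covered because the zeroth power is 1, which lies in no
  prime ideal.\<close>

lemma (in primeideal) pow_mem_imp: "a \<in> carrier R \<Longrightarrow> a [^] (n::nat) \<in> I \<Longrightarrow> a \<in> I"
  using pow_mem_iff[of a n] I_notcarr one_imp_carrier by (cases "n = 0") auto

text \<open>Removes the condition \<open>n > 0\<close> of \<open>radical\<close>: a vanishing power
  stays zero when its exponent is raised by one.\<close>

lemma (in cring) mem_nilradical_iff:
  "a \<in> nilradical R \<longleftrightarrow> a \<in> carrier R \<and> (\<exists>n::nat. a [^] n = \<zero>)"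
proof -
  have "a [^] Suc n = \<zero>" if "a \<in> carrier R" "a [^] n = \<zero>" for n
    using that by simp
  then show ?thesis
    unfolding nilradical_def radical_def by blast
qed

lemma (in cring) nilradical_subset_prime:
  assumes "primeideal P R"
  shows "nilradical R \<subseteq> P"
proof -
  interpret P: primeideal P R by fact
  show ?thesis
    using P.pow_mem_imp P.zero_closed mem_nilradical_iff by (metis subsetI)
qed

lemma (in cring) nilradical_subset_jacobson: "nilradical R \<subseteq> jacobson_radical R"
proof -
  have "a \<in> M" if "a \<in> nilradical R" "maximalideal M R" for a M
    using nilradical_subset_prime[OF maximalideal_prime] that by blast
  then show ?thesis
    by (auto simp: jacobson_radical_def mem_nilradical_iff)
qed

lemma (in cring) Units_not_mem_maximalideal:
  assumes "maximalideal M R" "x \<in> Units R"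
  shows "x \<notin> M"
proof
  interpret maximalideal M R by fact
  assume "x \<in> M"
  then have "inv x \<otimes> x \<in> M"
    using assms(2) by (intro I_l_closed) auto
  then show False
    using assms(2) one_imp_carrier I_notcarr by simp
qed

text \<open>If a maximal ideal \<open>M\<close> omitted \<open>a\<close>, then \<open>M\<close> and
  \<open>a\<close> would generate the unit ideal, so some 1 - ra would be a unit inside
  \<open>M\<close>.\<close>

lemma (in cring) mem_jacobson_radicalI:
  assumes a: "a \<in> carrier R" and units: "\<And>b. b \<in> carrier R \<Longrightarrow> \<one> \<ominus> b \<otimes> a \<in> Units R"
  shows "a \<in> jacobson_radical R"
  unfolding jacobson_radical_def
proof (intro CollectI conjI allI impI a)
  fix M assume "maximalideal M R"
  interpret M: maximalideal M R by fact
  show "a \<in> M"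
  proof (rule ccontr)
    assume "a \<notin> M"
    moreover note J = add_cgenideal[OF M.is_ideal a]
    moreover have "M <+>\<^bsub>R\<^esub> PIdl a \<subseteq> carrier R"
      using ideal.Icarr[OF J(1)] by blast
    ultimately have "M <+>\<^bsub>R\<^esub> PIdl a = carrier R"
      using M.I_maximal by blast
    then obtain p r where p: "p \<in> M" "r \<in> carrier R" "\<one> = p \<oplus> r \<otimes> a"
      by (metis mem_add_cgenideal_iff one_closed)
    have "\<one> \<ominus> r \<otimes> a = p"
      unfolding p(3) using a p(1,2) by (simp add: minus_eq a_assoc r_neg)
    then show False
      using Units_not_mem_maximalideal[OF \<open>maximalideal M R\<close>] units p by metis
  qed
qed

text \<open>The zero ring is excluded because its \<open>jacobson_radical\<close> is the whole ring.
  Any other ring has a maximal ideal, and that ideal contains no unit.\<close>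

lemma (in cring) Units_not_mem_jacobson:
  assumes "\<one> \<noteq> \<zero>" "x \<in> Units R"
  shows "x \<notin> jacobson_radical R"
proof -
  have "{\<zero>} \<noteq> carrier R"
    using assms(1) by (metis one_closed singletonD)
  then obtain M where "maximalideal M R"
    using exists_maximalideal_superset[OF zeroideal] by blast
  then show ?thesis
    using Units_not_mem_maximalideal assms(2) by (auto simp: jacobson_radical_def)
qed

section \<open>Radicals of rings of fractions\<close>

context denominators
begin

lemma frac_pow:
  assumes "a \<in> carrier R" "s \<in> S"
  shows "s [^] (n::nat) \<in> S" "frac R S a s [^]\<^bsub>fraction_ring R S\<^esub> n = frac R S (a [^] n) (s [^] n)"
proof -
  show S: "s [^] (n::nat) \<in> S" for n
    using assms S_one S_mult by (induction n) auto
  show "frac R S a s [^]\<^bsub>fraction_ring R S\<^esub> n = frac R S (a [^] n) (s [^] n)"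
    using assms S by (induction n) (simp_all add: fraction_ring_simps(2) frac_mult)
qed

lemma frac_eq_zero_iff':
  assumes "a \<in> carrier R" "s \<in> S"
  shows "frac R S a s = \<zero>\<^bsub>fraction_ring R S\<^esub> \<longleftrightarrow> (\<exists>u\<in>S. u \<otimes> a = \<zero>)"
  unfolding fraction_ring_simps(3) using assms S_one by (subst frac_eq_iff) auto

text \<open>The n-th power of a/s is a^n/s^n, and a fraction vanishes exactly when some denominator
  kills its numerator.\<close>

lemma frac_mem_nilradical_iff:
  assumes "a \<in> carrier R" "s \<in> S"
  shows "frac R S a s \<in> nilradical (fraction_ring R S) \<longleftrightarrow> (\<exists>u\<in>S. \<exists>n::nat. u \<otimes> a [^] n = \<zero>)"
proof -
  interpret F: cring "fraction_ring R S" by (rule fraction_ring_cring)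
  have "frac R S a s [^]\<^bsub>fraction_ring R S\<^esub> n = \<zero>\<^bsub>fraction_ring R S\<^esub>
      \<longleftrightarrow> (\<exists>u\<in>S. u \<otimes> a [^] n = \<zero>)" for n :: nat
    unfolding frac_pow(2)[OF assms] using assms by (intro frac_eq_zero_iff' frac_pow(1)) auto
  then show ?thesis
    unfolding F.mem_nilradical_iff using frac_closed[OF assms] by blast
qed

lemma frac_Units:
  assumes "a \<in> S" "s \<in> S"
  shows "frac R S a s \<in> Units (fraction_ring R S)"
proof -
  interpret F: cring "fraction_ring R S" by (rule fraction_ring_cring)
  have inv: "frac R S s a \<otimes>\<^bsub>fraction_ring R S\<^esub> frac R S a s = \<one>\<^bsub>fraction_ring R S\<^esub>"
    unfolding fraction_ring_simps(2) using assms S_one S_mult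
    by (subst frac_mult) (auto simp: frac_eq_iff m_comm intro!: bexI[of _ \<one>])
  have closed: "frac R S a s \<in> carrier (fraction_ring R S)" "frac R S s a \<in> carrier (fraction_ring R S)"
    using assms by (auto intro: frac_closed)
  with inv show ?thesis
    unfolding Units_def using F.m_comm[OF closed] by auto
qed

end

section \<open>Radicals of the localization at a prime ideal\<close>

context cring
begin

lemma frac_mem_nilradical_localization_iff:
  assumes "primeideal P R" "a \<in> carrier R" "s \<in> carrier R - P"
  shows "frac R (carrier R - P) a s \<in> nilradical (localization R P) \<longleftrightarrow> nil_at R P a"
  unfolding localization_def nil_at_def
  using denominators.frac_mem_nilradical_iff[OF primeideal_denominators[OF assms(1)] assms(2,3)] .

text \<open>This is the locality of R_P with maximal ideal P R_P. For \<open>a\<close> outside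
  \<open>P\<close> the fraction a/s is a unit; for \<open>a\<close> in \<open>P\<close> all elements
  1 - (b/t)(a/s) are units.\<close>

lemma frac_mem_jacobson_localization_iff:
  assumes "primeideal P R" and a: "a \<in> carrier R" and s: "s \<in> carrier R - P"
  shows "frac R (carrier R - P) a s \<in> jacobson_radical (localization R P) \<longleftrightarrow> a \<in> P"
proof -
  interpret P: primeideal P R by fact
  let ?S = "carrier R - P" and ?F = "localization R P"
  interpret D: denominators R ?S
    by (rule primeideal_denominators) fact
  interpret F: cring ?F
    by (rule localization_cring) fact
  have F: "?F = fraction_ring R ?S"
    by (simp add: localization_def)
  show ?thesis
  proof
    assume J: "frac R ?S a s \<in> jacobson_radical ?F"
    \<comment> \<open>Otherwise a denominator would annihilate 1, hence be zero and lie in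
      \<open>P\<close>.\<close>
    have "\<one>\<^bsub>?F\<^esub> \<noteq> \<zero>\<^bsub>?F\<^esub>"
      using D.frac_eq_zero_iff'[of \<one> \<one>] D.S_one unfolding F D.fraction_ring_simps(2) by auto
    then show "a \<in> P"
      using F.Units_not_mem_jacobson D.frac_Units[of a s] J a s unfolding F by blast
  next
    assume aP: "a \<in> P"
    show "frac R ?S a s \<in> jacobson_radical ?F"
    proof (rule F.mem_jacobson_radicalI)
      show "frac R ?S a s \<in> carrier ?F"
        unfolding F using a s by (rule D.frac_closed)
      fix y assume "y \<in> carrier ?F"
      then obtain b t where y: "y = frac R ?S b t" "b \<in> carrier R" "t \<in> ?S"
        unfolding F by (rule D.fraction_ring_E)
      \<comment> \<open>The fraction \<open>?v\<close> over \<open>?u\<close> is going to be 1 -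
        (b/t)(a/s).\<close>
      let ?u = "t \<otimes> s" and ?v = "t \<otimes> s \<ominus> b \<otimes> a"
      have u: "?u \<in> ?S"
        using y(3) s by (rule D.S_mult)
      have ba: "b \<otimes> a \<in> P"
        using aP y by (intro P.I_l_closed)
      have "?v \<oplus> b \<otimes> a = ?u"
        using a s y by (simp add: minus_eq a_assoc l_neg)
      \<comment> \<open>If \<open>?v\<close> were in \<open>P\<close>, then so would be
        \<open>?u\<close>, its sum with an element of \<open>P\<close>.\<close>
      then have v: "?v \<in> ?S"
        using u ba P.a_closed[of ?v "b \<otimes> a"] a s y by auto
      have yx: "y \<otimes>\<^bsub>?F\<^esub> frac R ?S a s = frac R ?S (b \<otimes> a) ?u"
        unfolding F y(1) using a s y by (intro D.frac_mult) auto
      have vc: "frac R ?S ?v ?u \<in> carrier ?F"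
        unfolding F using D.S_carrier[OF v] u by (rule D.frac_closed)
      have xc: "frac R ?S (b \<otimes> a) ?u \<in> carrier ?F"
        unfolding F using P.Icarr[OF ba] u by (rule D.frac_closed)
      \<comment> \<open>The difference is identified by checking that the sum v/u + ba/u equals 1.
        The formula of \<open>frac_add\<close> yields the denominator u^2 even though the two
        denominators agree.\<close>
      have "frac R ?S ?v ?u \<oplus>\<^bsub>?F\<^esub> frac R ?S (b \<otimes> a) ?u = frac R ?S (?u \<otimes> ?v \<oplus> ?u \<otimes> (b \<otimes> a)) (?u \<otimes> ?u)"
        unfolding F using D.S_carrier[OF v] u P.Icarr[OF ba] u by (rule D.frac_add)
      also have "?u \<otimes> ?v \<oplus> ?u \<otimes> (b \<otimes> a) = ?u \<otimes> ?u"
        using r_distr[OF D.S_carrier[OF v] P.Icarr[OF ba] D.S_carrier[OF u]]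
          \<open>?v \<oplus> b \<otimes> a = ?u\<close> by simp
      also have "frac R ?S (?u \<otimes> ?u) (?u \<otimes> ?u) = \<one>\<^bsub>?F\<^esub>"
        unfolding F D.fraction_ring_simps(2) using u D.S_mult[OF u u] D.S_one
        by (subst D.frac_eq_iff) (auto intro!: bexI[of _ \<one>])
      finally have "\<one>\<^bsub>?F\<^esub> \<ominus>\<^bsub>?F\<^esub> frac R ?S (b \<otimes> a) ?u = frac R ?S ?v ?u"
        using vc xc by (metis F.a_assoc F.a_inv_closed F.minus_eq F.r_neg F.r_zero)
      then show "\<one>\<^bsub>?F\<^esub> \<ominus>\<^bsub>?F\<^esub> y \<otimes>\<^bsub>?F\<^esub> frac R ?S a s \<in> Units ?F"
        unfolding yx using D.frac_Units[OF v u] by (simp add: F)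
    qed
  qed
qed

text \<open>The nilradical always lies in the Jacobson radical, so only the reverse inclusion
  counts. Whether a/s lies in either radical depends on \<open>a\<close> alone, which allows the
  choice s = 1.\<close>

lemma NJ_localization_iff:
  assumes "primeideal P R"
  shows "NJ_ring (localization R P) \<longleftrightarrow> (\<forall>a\<in>P. nil_at R P a)"
proof -
  interpret P: primeideal P R by fact
  interpret D: denominators R "carrier R - P"
    by (rule primeideal_denominators) fact
  interpret F: cring "localization R P"
    by (rule localization_cring) fact
  have carr: "carrier (localization R P)
      = {frac R (carrier R - P) a s |a s. a \<in> carrier R \<and> s \<in> carrier R - P}"
    by (simp add: localization_def D.fraction_ring_simps(1))
  have "NJ_ring (localization R P)
      \<longleftrightarrow> jacobson_radical (localization R P) \<subseteq> nilradical (localization R P)"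
    using F.nilradical_subset_jacobson by (auto simp: NJ_ring_def)
  also have "\<dots> \<longleftrightarrow> (\<forall>x\<in>carrier (localization R P).
      x \<in> jacobson_radical (localization R P) \<longrightarrow> x \<in> nilradical (localization R P))"
    by (auto simp: jacobson_radical_def)
  also have "\<dots> \<longleftrightarrow> (\<forall>a\<in>carrier R. \<forall>s\<in>carrier R - P.
      frac R (carrier R - P) a s \<in> jacobson_radical (localization R P)
        \<longrightarrow> frac R (carrier R - P) a s \<in> nilradical (localization R P))"
    unfolding carr by blast
  also have "\<dots> \<longleftrightarrow> (\<forall>a\<in>carrier R. \<forall>s\<in>carrier R - P. a \<in> P \<longrightarrow> nil_at R P a)"
    using frac_mem_jacobson_localization_iff[OF assms] frac_mem_nilradical_localization_iff[OF assms]
    by (intro ball_cong refl) simp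
  also have "\<dots> \<longleftrightarrow> (\<forall>a\<in>P. nil_at R P a)"
    using D.S_one P.Icarr by blast
  finally show ?thesis .
qed

section \<open>Local nilpotency\<close>

text \<open>The radical on the left consists of the elements that are \<open>nil_at\<close>
  \<open>P\<close>. These always belong to \<open>P\<close>, since s a^n = 0 is in \<open>P\<close>
  and \<open>s\<close> is not, so only the inclusion of \<open>P\<close> in the radical carries
  information.\<close>

lemma radical_kernel_localization_iff:
  assumes "primeideal P R"
  shows "radical R (a_kernel R (localization R P) (localization_map R P)) = P
    \<longleftrightarrow> (\<forall>a\<in>P. nil_at R P a)"
proof -
  interpret P: primeideal P R by fact
  \<comment> \<open>Raising the exponent reconciles \<open>nil_at\<close>, which admits exponent 0,
    with \<open>radical\<close>, which demands a positive one.\<close>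
  have suc: "s \<otimes> a [^] Suc n = \<zero>"
    if "s \<in> carrier R" "a \<in> carrier R" "s \<otimes> a [^] n = \<zero>" for s a and n :: nat
    using that m_assoc[of s "a [^] n" a] by simp
  have rad: "a \<in> radical R (a_kernel R (localization R P) (localization_map R P))
      \<longleftrightarrow> a \<in> carrier R \<and> nil_at R P a" for a
  proof -
    have "(\<exists>n::nat. n > 0 \<and> (\<exists>s\<in>carrier R - P. s \<otimes> a [^] n = \<zero>)) \<longleftrightarrow> nil_at R P a"
      if "a \<in> carrier R"
      unfolding nil_at_def using suc[OF _ that] by (metis DiffD1 zero_less_Suc)
    then show ?thesis
      unfolding radical_def a_kernel_localization_map[OF assms] by auto
  qed
  have "a \<in> P" if a: "a \<in> carrier R" "nil_at R P a" for a
  proof -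
    obtain s and n :: nat where s: "s \<in> carrier R - P" "s \<otimes> a [^] n = \<zero>"
      using a(2) by (auto simp: nil_at_def)
    then have "a [^] n \<in> P"
      using P.I_prime[of s "a [^] n"] P.zero_closed a(1) by auto
    with a(1) show ?thesis
      by (rule P.pow_mem_imp)
  qed
  with rad show ?thesis
    using P.Icarr by (metis subsetI subset_antisym)
qed

section \<open>Zero-dimensionality and local nilpotency\<close>

lemma zero_dimensional_imp_nil_at:
  assumes "zero_dimensional R" "maximalideal M R" "a \<in> M"
  shows "nil_at R M a"
proof (rule ccontr)
  assume not_nil: "\<not> nil_at R M a"
  interpret M: primeideal M R
    using assms(2) by (rule maximalideal_prime)
  interpret D: denominators R "carrier R - M"
    by (rule primeideal_denominators) (rule M.primeideal)
  have a: "a \<in> carrier R"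
    using assms(3) by (rule M.Icarr)
  define T where "T = {s \<otimes> a [^] n |s (n::nat). s \<in> carrier R - M}"
  have T: "s \<otimes> a [^] n \<in> T" if "s \<in> carrier R - M" for s and n :: nat
    unfolding T_def using that by blast
  \<comment> \<open>With exponent 0, \<open>T\<close> contains the complement of \<open>M\<close>;
    an ideal disjoint from \<open>T\<close> is therefore contained in \<open>M\<close>.\<close>
  have sub: "s \<in> T" if "s \<in> carrier R - M" for s
    using T[OF that, of 0] that by simp
  interpret T: denominators R T
  proof
    show "T \<subseteq> carrier R"
      unfolding T_def using a by auto
    show "\<one> \<in> T"
      using D.S_one by (rule sub)
    fix x y assume "x \<in> T" "y \<in> T"
    then obtain s t and m n :: nat where s: "s \<in> carrier R - M" "t \<in> carrier R - M"
      and x: "x = s \<otimes> a [^] m" "y = t \<otimes> a [^] n"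
      unfolding T_def by blast
    have "x \<otimes> y = (s \<otimes> t) \<otimes> a [^] (m + n)"
      using s a by (simp add: x nat_pow_mult[symmetric] m_ac)
    with T[OF D.S_mult[OF s]] show "x \<otimes> y \<in> T"
      by simp
  qed
  have "\<zero> \<notin> T"
    using not_nil unfolding T_def nil_at_def mem_Collect_eq by metis
  then obtain P where P: "primeideal P R" "P \<inter> T = {}"
    by (rule T.exists_prime_disjoint)
  interpret P: maximalideal P R
    using P(1) assms(1) by (simp add: zero_dimensional_def)
  have "P \<subseteq> M"
    using P(2) P.Icarr sub by blast
  \<comment> \<open>Zero-dimensionality made \<open>P\<close> maximal, so it cannot lie strictly
    below \<open>M\<close>. The clash is then at \<open>a\<close>, which is in \<open>M\<close> by
    assumption and in \<open>T\<close> as 1 times its first power.\<close>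
  then have "M = P"
    using P.I_maximal[OF M.is_ideal] M.I_notcarr M.Icarr by blast
  moreover have "a \<in> T"
    using T[OF D.S_one, of 1] a by simp
  ultimately show False
    using assms(3) P(2) by blast
qed

text \<open>Let \<open>M\<close> be a maximal ideal above the prime \<open>P\<close>. For
  \<open>a\<close> in \<open>M\<close> there is a relation s a^n = 0 with \<open>s\<close> outside
  \<open>M\<close>, hence outside \<open>P\<close>, so primeness puts \<open>a\<close> into
  \<open>P\<close> and the two ideals coincide.\<close>

lemma nil_at_imp_zero_dimensional:
  assumes nil: "\<And>M a. maximalideal M R \<Longrightarrow> a \<in> M \<Longrightarrow> nil_at R M a"
  shows "zero_dimensional R"
  unfolding zero_dimensional_def
proof (intro allI impI)
  fix P assume "primeideal P R"
  interpret P: primeideal P R by fact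
  obtain M where M: "maximalideal M R" "P \<subseteq> M"
    using exists_maximalideal_superset[OF P.is_ideal] P.I_notcarr by metis
  interpret M: maximalideal M R by fact
  have "a \<in> P" if a: "a \<in> M" for a
  proof -
    obtain s and n :: nat where s: "s \<in> carrier R - M" "s \<otimes> a [^] n = \<zero>"
      using nil[OF M(1) a] by (auto simp: nil_at_def)
    then have "a [^] n \<in> P"
      using P.I_prime[of s "a [^] n"] P.zero_closed M.Icarr[OF a] M(2) by auto
    with M.Icarr[OF a] show ?thesis
      by (rule P.pow_mem_imp)
  qed
  with M show "maximalideal P R"
    by (metis subsetI subset_antisym)
qed

section \<open>N-purity and local nilpotency\<close>

lemma ideal_power_annihilator:
  assumes a: "a \<in> carrier R"
  shows "ideal {x \<in> carrier R. \<exists>n::nat. x \<otimes> a [^] n = \<zero>} R" (is "ideal ?J R")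
proof (rule idealI[OF ring_axioms])
  have mult: "x \<otimes> y \<in> ?J" if yJ: "y \<in> ?J" and x: "x \<in> carrier R" for x y
  proof -
    obtain n :: nat where y: "y \<in> carrier R" "y \<otimes> a [^] n = \<zero>"
      using yJ by blast
    then have "x \<otimes> y \<otimes> a [^] n = \<zero>"
      using a x by (simp add: m_assoc)
    with y(1) x show ?thesis
      by blast
  qed
  show "x \<otimes> y \<in> ?J" "y \<otimes> x \<in> ?J" if "y \<in> ?J" "x \<in> carrier R" for x y
    using mult[OF that] that m_comm[of x y] by auto
  show "subgroup ?J (add_monoid R)"
  proof
    show "?J \<subseteq> carrier (add_monoid R)" "\<one>\<^bsub>add_monoid R\<^esub> \<in> ?J"
      using a by auto
  next
    fix x y assume "x \<in> ?J" "y \<in> ?J"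
    then obtain m n :: nat where x: "x \<in> carrier R" "x \<otimes> a [^] m = \<zero>"
      and y: "y \<in> carrier R" "y \<otimes> a [^] n = \<zero>"
      by blast
    \<comment> \<open>The annihilators of the powers increase with the exponent, so m + n serves
      both summands.\<close>
    have "(x \<oplus> y) \<otimes> a [^] (m + n) = (x \<otimes> a [^] m) \<otimes> a [^] n \<oplus> (y \<otimes> a [^] n) \<otimes> a [^] m"
      using a x(1) y(1) by (simp add: nat_pow_mult[symmetric] l_distr r_distr m_ac)
    also have "\<dots> = \<zero>"
      using a by (simp add: x y)
    finally show "x \<otimes>\<^bsub>add_monoid R\<^esub> y \<in> ?J"
      using x(1) y(1) by auto
  next
    fix x assume "x \<in> ?J"
    then show "inv\<^bsub>add_monoid R\<^esub> x \<in> ?J"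
      using a by (auto simp: a_inv_def[symmetric] l_minus)
  qed
qed

lemma nil_at_imp_N_pure:
  assumes nil: "\<And>M a. maximalideal M R \<Longrightarrow> a \<in> M \<Longrightarrow> nil_at R M a" and "ideal I R"
  shows "N_pure R I"
  unfolding N_pure_def
proof
  interpret I: ideal I R by fact
  fix a assume "a \<in> I"
  then have a: "a \<in> carrier R"
    by (rule I.Icarr)
  \<comment> \<open>For an ideal \<open>M\<close>, the condition \<open>nil_at R M a\<close> says
    exactly that \<open>?J\<close> is not contained in \<open>M\<close>.\<close>
  let ?J = "{x \<in> carrier R. \<exists>n::nat. x \<otimes> a [^] n = \<zero>}"
  note K = add_cgenideal[OF ideal_power_annihilator[OF a] a]
  \<comment> \<open>A maximal ideal containing the sum would contain both \<open>a\<close> and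
    \<open>?J\<close>, against local nilpotency of \<open>a\<close>.\<close>
  have "?J <+>\<^bsub>R\<^esub> PIdl a = carrier R"
  proof (rule ccontr)
    assume "?J <+>\<^bsub>R\<^esub> PIdl a \<noteq> carrier R"
    then obtain M where M: "maximalideal M R" "?J <+>\<^bsub>R\<^esub> PIdl a \<subseteq> M"
      using exists_maximalideal_superset[OF K(1)] by blast
    then have "nil_at R M a"
      using K(3) nil by blast
    then show False
      using K(2) M(2) unfolding nil_at_def by blast
  qed
  then have "\<one> \<in> ?J <+>\<^bsub>R\<^esub> PIdl a"
    by simp
  then obtain x r where "x \<in> ?J" and r: "r \<in> carrier R" "\<one> = x \<oplus> r \<otimes> a"
    unfolding mem_add_cgenideal_iff by blast
  then obtain n :: nat where x: "x \<in> carrier R" "x \<otimes> a [^] n = \<zero>"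
    by blast
  have "\<one> \<ominus> r \<otimes> a = x"
    unfolding r(2) using x(1) r(1) a by (simp add: minus_eq a_assoc r_neg)
  \<comment> \<open>The exponent \<open>Suc n\<close> leaves a factor \<open>x\<close> to pair with
    a^n even when \<open>n\<close> is 0.\<close>
  moreover have "(a \<otimes> x) [^] Suc n = (x [^] n \<otimes> a \<otimes> (x \<otimes> a [^] n))"
    using a x(1) by (simp add: nat_pow_distrib m_ac)
  then have "(a \<otimes> x) [^] Suc n = \<zero>"
    using a x(1) unfolding x(2) by simp
  ultimately have "a \<otimes> (\<one> \<ominus> r \<otimes> a) \<in> nilradical R"
    unfolding mem_nilradical_iff using a x(1) by blast
  moreover have "r \<otimes> a \<in> I"
    using \<open>a \<in> I\<close> r(1) by (rule I.I_l_closed)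
  ultimately show "\<exists>b\<in>I. a \<otimes> (\<one> \<ominus> b) \<in> nilradical R"
    by blast
qed

text \<open>As \<open>b\<close> lies in \<open>P\<close>, the element 1 - b does not, and neither do
  its powers. Expanding the vanishing power of a(1 - b) shows that (1 - b)^n annihilates
  a^n.\<close>

lemma N_pure_imp_nil_at:
  assumes "N_pure R I" "a \<in> I" "primeideal P R" "I \<subseteq> P"
  shows "nil_at R P a"
proof -
  interpret P: primeideal P R by fact
  interpret D: denominators R "carrier R - P"
    by (rule primeideal_denominators) fact
  obtain b where b: "b \<in> I" "a \<otimes> (\<one> \<ominus> b) \<in> nilradical R"
    using assms(1,2) by (auto simp: N_pure_def)
  then obtain n :: nat where n: "(a \<otimes> (\<one> \<ominus> b)) [^] n = \<zero>"
    by (auto simp: mem_nilradical_iff)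
  have c: "a \<in> carrier R" "b \<in> carrier R"
    using assms(2,4) b(1) P.Icarr by auto
  have "\<one> \<ominus> b \<oplus> b = \<one>"
    using c by (simp add: minus_eq a_assoc l_neg)
  then have "\<one> \<ominus> b \<in> carrier R - P"
    using P.a_closed[of "\<one> \<ominus> b" b] b(1) assms(4) c D.S_one by auto
  then have "(\<one> \<ominus> b) [^] n \<in> carrier R - P"
    using P.pow_mem_imp by blast
  moreover have "(\<one> \<ominus> b) [^] n \<otimes> a [^] n = \<zero>"
    using n c by (simp add: nat_pow_distrib m_comm)
  ultimately show ?thesis
    unfolding nil_at_def by blast
qed

lemma zero_dimensional_iff_nil_at:
  "zero_dimensional R \<longleftrightarrow> (\<forall>M. maximalideal M R \<longrightarrow> (\<forall>a\<in>M. nil_at R M a))"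
  using zero_dimensional_imp_nil_at nil_at_imp_zero_dimensional by blast

lemma zero_dimensional_imp_N_pure: "zero_dimensional R \<Longrightarrow> ideal I R \<Longrightarrow> N_pure R I"
  using zero_dimensional_imp_nil_at nil_at_imp_N_pure by blast

end

theorem theorem3p4:
  fixes R :: "('a, 'm) ring_scheme"
  assumes "cring R"
  shows "(zero_dimensional R \<longleftrightarrow> (\<forall>I. ideal I R \<longrightarrow> N_pure R I)) \<and>
    (zero_dimensional R \<longleftrightarrow> (\<forall>I. principalideal I R \<longrightarrow> N_pure R I)) \<and>
    (zero_dimensional R \<longleftrightarrow> (\<forall>M. maximalideal M R \<longrightarrow> N_pure R M)) \<and>
    (zero_dimensional R \<longleftrightarrow>
      (\<forall>M. maximalideal M R \<longrightarrow>
        radical R (a_kernel R (localization R M) (localization_map R M)) = M)) \<and>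
    (zero_dimensional R \<longleftrightarrow> (\<forall>P. primeideal P R \<longrightarrow> NJ_ring (localization R P))) \<and>
    (zero_dimensional R \<longleftrightarrow> (\<forall>M. maximalideal M R \<longrightarrow> NJ_ring (localization R M)))"
proof -
  interpret cring R by fact
  have prime: "primeideal M R" if "maximalideal M R" for M
    using that by (rule maximalideal_prime)
  have max_ideal: "ideal M R" if "maximalideal M R" for M
    using that by (rule maximalideal.axioms(1))
  have iii: "zero_dimensional R" if pure: "\<forall>I. principalideal I R \<longrightarrow> N_pure R I"
    unfolding zero_dimensional_iff_nil_at
  proof (intro allI impI ballI)
    fix M a assume M: "maximalideal M R" and "a \<in> M"
    then have a: "a \<in> carrier R"
      using ideal.Icarr[OF max_ideal] by blast
    show "nil_at R M a"
    \<comment> \<open>Purity is applied to the principal ideal of \<open>a\<close>, which lies in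
      \<open>M\<close> because \<open>a\<close> does.\<close>
    proof (rule N_pure_imp_nil_at)
      show "N_pure R (PIdl\<^bsub>R\<^esub> a)"
        using pure cgenideal_is_principalideal[OF a] by blast
      show "a \<in> PIdl\<^bsub>R\<^esub> a"
        using a by (rule cgenideal_self)
      show "primeideal M R"
        using M by (rule prime)
      show "PIdl\<^bsub>R\<^esub> a \<subseteq> M"
        using max_ideal[OF M] \<open>a \<in> M\<close> by (rule cgenideal_minimal)
    qed
  qed
  \<comment> \<open>Here the pure ideal is \<open>M\<close> itself.\<close>
  have iv: "zero_dimensional R" if "\<forall>M. maximalideal M R \<longrightarrow> N_pure R M"
    unfolding zero_dimensional_iff_nil_at using that N_pure_imp_nil_at prime by blast
  have v: "zero_dimensional R \<longleftrightarrow> (\<forall>M. maximalideal M R \<longrightarrow>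
      radical R (a_kernel R (localization R M) (localization_map R M)) = M)"
    unfolding zero_dimensional_iff_nil_at using radical_kernel_localization_iff prime by blast
  have vii: "zero_dimensional R \<longleftrightarrow> (\<forall>M. maximalideal M R \<longrightarrow> NJ_ring (localization R M))"
    unfolding zero_dimensional_iff_nil_at using NJ_localization_iff prime by blast
  \<comment> \<open>Maximal ideals are prime, so the condition on primes implies
    \<open>vii\<close>'s; conversely, zero-dimensionality makes every prime one of the maximal
    ideals that \<open>vii\<close> treats.\<close>
  then have vi: "zero_dimensional R \<longleftrightarrow> (\<forall>P. primeideal P R \<longrightarrow> NJ_ring (localization R P))"
    using prime unfolding zero_dimensional_def by blast
  \<comment> \<open>Purity of all ideals includes that of the principal and of the maximal ones, so
    its converse implication follows from \<open>iii\<close> or \<open>iv\<close>.\<close>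
  show ?thesis
    using zero_dimensional_imp_N_pure iii iv v vi vii max_ideal principalideal.axioms(1) by metis
qed

end
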